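(* Let $Y$ be a graph with $n\geq 3$ vertices. The graph $\mathsf{FS}(\mathsf{Cycle}_n,Y)$ is connected if and only if $\overline Y$ is a forest consisting of trees $\mathscr T_1,\ldots,\mathscr T_r$ such that $\gcd(|V(\mathscr T_1)|,\ldots,|V(\mathscr T_r)|)=1$.
   Context: All graphs are finite and simple; $[n]=\{1,\ldots,n\}$; $\overline Y$ is the complement of $Y$. For graphs $X,Y$ with $|V(X)|=|V(Y)|$, the friends-and-strangers graph $\mathsf{FS}(X,Y)$ has as vertices all bijections $\sigma\colon V(X)\to V(Y)$; two bijections $\sigma,\sigma'$ are adjacent iff there is an edge $\{a,b\}\in E(X)$ with $\{\sigma(a),\sigma(b)\}\in E(Y)$, $\sigma(a)=\sigma'(b)$, $\sigma(b)=\sigma'(a)$, and $\sigma(c)=\sigma'(c)$ for all $c\in V(X)\setminus\{a,b\}$. $\mathsf{Cycle}_n$ is the graph with vertex set $[n]$ and edge set $\{\{i,i+1\}:1\le i\le n-1\}\cup\{\{n,1\}\}$. The trees $\mathscr T_1,\ldots,\mathscr T_r$ of a forest are its connected components (isolated vertices count as trees with one vertex). *)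

theory Defs
  imports "Graph_Theory.Digraph_Component" "HOL-Library.FuncSet"
begin

text \<open>
  A finite simple graph is a \<^locale>\<open>pair_graph\<close>: a finite vertex set with a symmetric, irreflexive
  arc relation, so that the edge $\{u,v\}$ appears as the two arcs $(u,v)$ and $(v,u)$.
\<close>

definition complement_graph :: "'a pair_pre_digraph \<Rightarrow> 'a pair_pre_digraph" where
  "complement_graph G =
     \<lparr> pverts = pverts G,
       parcs = {(u, v). u \<in> pverts G \<and> v \<in> pverts G \<and> u \<noteq> v \<and> (u, v) \<notin> parcs G} \<rparr>"

definition cycle_graph :: "nat \<Rightarrow> nat pair_pre_digraph" where
  "cycle_graph n =
     (let E = {(i, i + 1) | i. 1 \<le> i \<and> i \<le> n - 1} \<union> {(n, 1)}
      in \<lparr> pverts = {1..n}, parcs = E \<union> E\<inverse> \<rparr>)"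

text \<open>
  The vertices are the bijections between the two vertex sets, taken as extensional functions (with
  value \<^const>\<open>undefined\<close> outside \<^term>\<open>pverts X\<close>) so that each bijection is represented only once.
\<close>

definition FS :: "'a pair_pre_digraph \<Rightarrow> 'b pair_pre_digraph \<Rightarrow> ('a \<Rightarrow> 'b) pair_pre_digraph" where
  "FS X Y =
     (let V = {\<sigma> \<in> pverts X \<rightarrow>\<^sub>E pverts Y. bij_betw \<sigma> (pverts X) (pverts Y)}
      in \<lparr> pverts = V,
           parcs = {(\<sigma>, \<sigma>'). \<sigma> \<in> V \<and> \<sigma>' \<in> V \<and>
             (\<exists>a b. (a, b) \<in> parcs X \<and> (\<sigma> a, \<sigma> b) \<in> parcs Y \<and>
                    \<sigma> a = \<sigma>' b \<and> \<sigma> b = \<sigma>' a \<and>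
                    (\<forall>c \<in> pverts X - {a, b}. \<sigma> c = \<sigma>' c))} \<rparr>)"

text \<open>
  The directed \<^const>\<open>forest\<close> is not usable here: in a symmetric digraph every edge yields the directed
  cycle $u, v, u$ of length 2. Without loops, the directed cycles of length at least 3 are exactly
  the cycles of the undirected graph.
\<close>

definition undirected_forest :: "'a pair_pre_digraph \<Rightarrow> bool" where
  "undirected_forest G \<longleftrightarrow> \<not> (\<exists>p. pre_digraph.cycle (with_proj G) p \<and> length p \<ge> 3)"

text \<open>
  In a symmetric digraph the strongly connected components are the connected components of the
  undirected graph, each as an induced subgraph.
\<close>

abbreviation components :: "'a pair_pre_digraph \<Rightarrow> ('a, 'a \<times> 'a) pre_digraph set" where
  "components G \<equiv> pre_digraph.sccs (with_proj G)"

lemma pair_graph_iff: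
  "pair_graph G \<longleftrightarrow> finite (pverts G) \<and> parcs G \<subseteq> pverts G \<times> pverts G \<and> sym (parcs G) \<and> irrefl (parcs G)"
proof
  assume "pair_graph G"
  then interpret pair_graph G .
  show "finite (pverts G) \<and> parcs G \<subseteq> pverts G \<times> pverts G \<and> sym (parcs G) \<and> irrefl (parcs G)"
    using pair_finite_verts arcs_symmetric no_loops'
    by (auto simp: sym_def irrefl_def dest: arc_fst_in_verts arc_snd_in_verts)
next
  assume *: "finite (pverts G) \<and> parcs G \<subseteq> pverts G \<times> pverts G \<and> sym (parcs G) \<and> irrefl (parcs G)"
  then have "finite (parcs G)" by (meson finite_SigmaI finite_subset)
  with * show "pair_graph G"
    by unfold_locales (auto simp: symmetric_def irrefl_def)
qed

lemma pair_graph_complement_graph: "pair_graph G \<Longrightarrow> pair_graph (complement_graph G)"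
  by (auto simp: pair_graph_iff complement_graph_def sym_def irrefl_def)

lemma pair_graph_cycle_graph: "n \<ge> 2 \<Longrightarrow> pair_graph (cycle_graph n)"
  by (auto simp: pair_graph_iff cycle_graph_def sym_def irrefl_def Let_def)

lemma pair_graph_FS:
  assumes "pair_graph X" "pair_graph Y"
  shows "pair_graph (FS X Y)"
proof -
  have "finite (pverts X \<rightarrow>\<^sub>E pverts Y)"
    using assms by (auto simp: pair_graph_iff intro: finite_PiE)
  moreover have "sym (parcs (FS X Y))"
  proof (rule symI)
    fix \<sigma> \<tau> assume "(\<sigma>, \<tau>) \<in> parcs (FS X Y)"
    then obtain a b where "(a, b) \<in> parcs X" "(\<sigma> a, \<sigma> b) \<in> parcs Y" "\<sigma> a = \<tau> b" "\<sigma> b = \<tau> a"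
      "\<forall>c \<in> pverts X - {a, b}. \<sigma> c = \<tau> c" "\<sigma> \<in> pverts (FS X Y)" "\<tau> \<in> pverts (FS X Y)"
      by (auto simp: FS_def Let_def)
    moreover from this have "(\<tau> a, \<tau> b) \<in> parcs Y"
      using assms(2) by (auto simp: pair_graph_iff dest: symD)
    ultimately show "(\<tau>, \<sigma>) \<in> parcs (FS X Y)"
      by (simp add: FS_def Let_def) metis
  qed
  moreover have "irrefl (parcs (FS X Y))"
    using assms(2) by (auto simp: irrefl_def FS_def Let_def pair_graph_iff)
  ultimately show ?thesis
    by (auto simp: pair_graph_iff FS_def Let_def)
qed

end

theory Submission
  imports Defs
begin

text \<open>
  Call two people strangers if they are adjacent in the complement of \<open>Y\<close>. An arrangement
  of the people on the cycle is unrolled onto the integers: a lift assigns to each person an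
  integer that is congruent modulo \<open>n\<close> to that person's position on the cycle. A swap of two
  friends in neighbouring positions moves one lifted position up by 1 and the other one down by 1, so
  it preserves the sum of all lifted positions. Two strangers never pass each other, on either side of
  the cycle, so for strangers \<open>u\<close>, \<open>v\<close> the difference \<open>p u - p v\<close> stays in the same
  window between consecutive multiples of \<open>n\<close>; that is, its quotient by \<open>n\<close> is invariant
  (\<open>lift_path\<close>).

  These invariants are complete: two lifts with equal sums and equal windows are joined by swaps
  (\<open>connected_if_same_sum_same_windows\<close>). If the displacements \<open>q v - p v\<close> do not all
  vanish, somewhere on the cycle a person who has to move further forward stands directly behind one
  who has to move less far forward. The windows force these two to be friends, and swapping them
  decreases the sum of the squared displacements.

  It remains to decide when any two arrangements have lifts with the same invariants. The lifts of an
  arrangement differ by multiples \<open>n * k v\<close>.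

  Call the friends-and-strangers graph the swap graph. If it is connected, a path from an
  arrangement to its rotation by one position changes the lift by \<open>1 + n * k v\<close>. Equality of the windows makes \<open>k\<close> constant on every component of
  the stranger graph, and equality of the sums says that \<open>k\<close> sums to \<open>-1\<close>. So \<open>-1\<close> is an
  integer combination of the component sizes, whose gcd is therefore 1 (\<open>connected_imp_Gcd\<close>).
  Also, the stranger graph has no cycle of length at least 3: the windows along such a cycle record
  how often it winds around the positions, and arranging it clockwise or anticlockwise gives
  different winding numbers (\<open>no_long_stranger_cycle\<close>).

  Conversely, if the stranger graph is a forest, any antisymmetric choice of differences of \<open>k\<close>
  along its edges can be realized (\<open>bridges_imp_potential\<close>), so the windows of any two arrangements can be made
  equal. The sums of the two lifts then differ by a multiple of \<open>n\<close>. Moving a component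
  \<open>T\<close> as a whole by \<open>n\<close> changes the sum by \<open>n * card T\<close> and leaves the windows alone, so by
  Bezout the sums can be made equal when the gcd of the sizes is 1
  (\<open>forest_Gcd_imp_connected\<close>).
\<close>

section \<open>Integer division and Bezout coefficients\<close>

lemma zdiv_add_one_eq:
  fixes z n :: int
  assumes "n > 0" "\<not> n dvd z + 1"
  shows "(z + 1) div n = z div n"
proof -
  have "z mod n + 1 \<noteq> n"
    using assms(2) by (metis dvd_refl mod_add_left_eq dvd_eq_mod_eq_0)
  moreover have "z mod n < n" "0 \<le> z mod n" using assms by simp_all
  ultimately have "(z mod n + 1) div n = 0" by simp
  moreover have "(z + 1) div n = (z mod n + 1 + z div n * n) div n"
    by (simp add: algebra_simps)
  moreover have "(z mod n + 1 + z div n * n) div n = z div n + (z mod n + 1) div n"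
    using assms(1) by (intro div_mult_self1) simp
  ultimately show ?thesis by simp
qed

lemma zdiv_minus_not_dvd:
  fixes z n :: int
  assumes "n > 0" "\<not> n dvd z"
  shows "(- z) div n = - (z div n) - 1"
  using assms zdiv_zminus1_eq_if[of n z] by (simp add: dvd_eq_mod_eq_0)

lemma Bezout_Gcd:
  fixes f :: "'b \<Rightarrow> nat"
  assumes "finite A"
  shows "\<exists>k. (\<Sum>x\<in>A. k x * int (f x)) = int (Gcd (f ` A))"
  using assms
proof induction
  case (insert x A)
  then obtain k where k: "(\<Sum>x\<in>A. k x * int (f x)) = int (Gcd (f ` A))" by auto
  obtain c d where "c * int (f x) + d * int (Gcd (f ` A)) = gcd (int (f x)) (int (Gcd (f ` A)))"
    using bezout_int by blast
  moreover have "(\<Sum>y\<in>A. (if y = x then c else d * k y) * int (f y)) = d * (\<Sum>y\<in>A. k y * int (f y))"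
    using insert.hyps by (auto simp: sum_distrib_left mult.assoc intro!: sum.cong)
  ultimately have "(\<Sum>y\<in>insert x A. (if y = x then c else d * k y) * int (f y)) = int (Gcd (f ` insert x A))"
    using insert.hyps k by simp
  then show ?case by (rule exI[where P = "\<lambda>k. (\<Sum>y\<in>insert x A. k y * int (f y)) = _"])
qed simp

section \<open>Potentials on forests\<close>

text \<open>
  By induction on the edge set. Removing an edge \<open>{a, b}\<close> separates \<open>a\<close> from \<open>b\<close>, so a
  potential for the remaining edges can be shifted by a constant on the side of \<open>b\<close> until the
  difference along \<open>{a, b}\<close> is right as well.
\<close>

lemma bridges_imp_potential:
  fixes w :: "'a \<Rightarrow> 'a \<Rightarrow> int"
  assumes "finite E" "sym E"
    and "\<And>a b. (a, b) \<in> E \<Longrightarrow> (a, b) \<notin> (E - {(a, b), (b, a)})\<^sup>*"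
    and w: "\<And>u v. (u, v) \<in> E \<Longrightarrow> w v u = - w u v"
  shows "\<exists>k. \<forall>(u, v) \<in> E. k v - k u = w u v"
  using assms
proof (induction E rule: finite_psubset_induct)
  case (psubset E)
  show ?case
  proof (cases "E = {}")
    case False
    then obtain a b where ab: "(a, b) \<in> E" by auto
    define F where "F = E - {(a, b), (b, a)}"
    have symF: "sym F" using \<open>sym E\<close> by (auto simp: F_def sym_def)
    have "(c, d) \<notin> (F - {(c, d), (d, c)})\<^sup>*" if "(c, d) \<in> F" for c d
    proof -
      have "(F - {(c, d), (d, c)})\<^sup>* \<subseteq> (E - {(c, d), (d, c)})\<^sup>*"
        by (rule rtrancl_mono) (auto simp: F_def)
      with psubset.prems(2)[of c d] that show ?thesis by (auto simp: F_def)
    qed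
    moreover have "F \<subset> E" using ab by (auto simp: F_def)
    ultimately obtain k where k: "\<forall>(u, v) \<in> F. k v - k u = w u v"
      using psubset.IH[of F] symF psubset.prems(3) by (auto simp: F_def)
    define S where "S = {v. (b, v) \<in> F\<^sup>*}"
    have "b \<in> S" by (simp add: S_def)
    have "a \<notin> S"
      using psubset.prems(2)[OF ab] sym_rtrancl[OF symF] by (auto simp: S_def F_def dest: symD)
    have S: "u \<in> S \<longleftrightarrow> v \<in> S" if "(u, v) \<in> F" for u v
      using that symF unfolding S_def by (auto intro: rtrancl_into_rtrancl dest: symD)
    define k' where "k' v = k v + (if v \<in> S then w a b - k b + k a else 0)" for v
    have "k' v - k' u = w u v" if "(u, v) \<in> E" for u v
    proof (cases "(u, v) \<in> F")
      case True
      with k S[OF True] show ?thesis by (auto simp: k'_def)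
    next
      case False
      with that have "(u, v) = (a, b) \<or> (u, v) = (b, a)" by (auto simp: F_def)
      then show ?thesis
        using \<open>a \<notin> S\<close> \<open>b \<in> S\<close> psubset.prems(3)[OF ab] by (auto simp: k'_def)
    qed
    then show ?thesis by blast
  qed simp
qed

text \<open>
  A connection of the ends of an edge that avoids this edge can be shortened to a path, which has
  length at least 2 and closes up with the edge to a cycle of length at least 3.
\<close>

lemma undirected_forest_edge_bridge:
  assumes "pair_graph G" "undirected_forest G" "(a, b) \<in> parcs G"
  shows "(a, b) \<notin> (parcs G - {(a, b), (b, a)})\<^sup>*"
proof
  assume *: "(a, b) \<in> (parcs G - {(a, b), (b, a)})\<^sup>*"
  interpret pair_graph G by fact
  define H where "H = \<lparr> pverts = pverts G, parcs = parcs G - {(a, b), (b, a)} \<rparr>"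
  have "pair_graph H"
    using assms(1) by (auto simp: pair_graph_iff H_def sym_def irrefl_def)
  then interpret H: pair_graph H .
  have ab: "a \<noteq> b" "a \<in> pverts G" "b \<in> pverts G"
    using assms(3) no_loops' in_arcsD1 in_arcsD2 by auto
  with * have "(a, b) \<in> (parcs H)\<^sup>+" by (simp add: H_def rtrancl_eq_or_trancl)
  then have "a \<rightarrow>\<^sup>*\<^bsub>H\<^esub> b" using H.reachable1_reachable by simp
  then obtain q where q: "H.apath a q b" using H.reachable_apath by blast
  have "subgraph H G"
    by (intro subgraphI) (auto simp: H_def compatible_def H.wf_digraph wf_digraph
        intro: H.wf_digraph[unfolded H_def])
  then have aq: "apath a q b" using q subgraph_apath_imp_apath by blast
  have set_q: "set q \<subseteq> parcs H" using q by (auto simp: pre_digraph.apath_def pre_digraph.awalk_def)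
  have "q \<noteq> []" using q ab by (auto simp: H.apath_Nil_iff)
  moreover have "q \<noteq> [e]" for e
  proof
    assume "q = [e]"
    with q have "e = (a, b)" "e \<in> parcs H"
      by (auto simp: H.apath_Cons_iff H.apath_Nil_iff prod_eq_iff)
    then show False by (simp add: H_def)
  qed
  ultimately have len: "length q \<ge> 2" by (cases q; cases "tl q"; auto)
  have ba: "(b, a) \<in> parcs G" using assms(3) by (rule arcs_symmetric)
  have "awalk b ((b, a) # q) b"
    using aq ba by (auto simp: awalk_Cons_iff apath_def)
  moreover have "distinct (tl (awalk_verts b ((b, a) # q)))"
    using aq by (auto simp: apath_def)
  ultimately have "cycle ((b, a) # q)" by (auto simp: cycle_def)
  with assms(2) len show False by (auto simp: undirected_forest_def)
qed

section \<open>Lifts of arrangements to the integers\<close>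

locale friends_on_cycle =
  fixes Y :: "'a pair_pre_digraph" and n :: nat
  assumes pair_graph_Y: "pair_graph Y"
    and card_Y: "card (pverts Y) = n"
    and n_ge_3: "n \<ge> 3"
begin

abbreviation "V \<equiv> pverts Y"
abbreviation "E \<equiv> parcs (complement_graph Y)"
abbreviation "X \<equiv> cycle_graph n"

text \<open>
  The lift is determined by the arrangement up to multiples of \<open>n\<close> for each person, and determines
  the arrangement. It is a function of the person, not of the position, because a swap then changes
  just two of its values, each by 1.
\<close>

definition lifts :: "('a \<Rightarrow> int) \<Rightarrow> (nat \<Rightarrow> 'a) \<Rightarrow> bool" where
  "lifts p \<sigma> \<longleftrightarrow> \<sigma> \<in> pverts (FS X Y) \<and> (\<forall>i\<in>{1..n}. p (\<sigma> i) mod int n = int i mod int n)"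

text \<open>
  The quotient \<open>(p u - p v) div n\<close> counts how many full turns \<open>u\<close> is ahead of \<open>v\<close>. It can
  only change when the two pass each other, which strangers never do.
\<close>

definition same_windows :: "('a \<Rightarrow> int) \<Rightarrow> ('a \<Rightarrow> int) \<Rightarrow> bool" where
  "same_windows p q \<longleftrightarrow> (\<forall>(u, v)\<in>E. (p u - p v) div int n = (q u - q v) div int n)"

definition shift :: "'a \<Rightarrow> 'a \<Rightarrow> ('a \<Rightarrow> int) \<Rightarrow> 'a \<Rightarrow> int" where
  "shift x y p = p(x := p x + 1, y := p y - 1)"

lemma finite_V: "finite V"
  using pair_graph_Y by (simp add: pair_graph_iff)

lemma FS_verts: "\<sigma> \<in> pverts (FS X Y) \<longleftrightarrow> \<sigma> \<in> {1..n} \<rightarrow>\<^sub>E V \<and> bij_betw \<sigma> {1..n} V"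
  by (simp add: FS_def cycle_graph_def Let_def)

lemma FS_arcs:
  "(\<sigma>, \<tau>) \<in> parcs (FS X Y) \<longleftrightarrow> \<sigma> \<in> pverts (FS X Y) \<and> \<tau> \<in> pverts (FS X Y) \<and>
     (\<exists>a b. (a, b) \<in> parcs X \<and> (\<sigma> a, \<sigma> b) \<in> parcs Y \<and> \<sigma> a = \<tau> b \<and> \<sigma> b = \<tau> a \<and>
        (\<forall>c \<in> {1..n} - {a, b}. \<sigma> c = \<tau> c))"
  by (simp add: FS_def cycle_graph_def Let_def)

lemma E_iff: "(u, v) \<in> E \<longleftrightarrow> u \<in> V \<and> v \<in> V \<and> u \<noteq> v \<and> (u, v) \<notin> parcs Y"
  by (simp add: complement_graph_def)

lemma sym_E: "sym E" and finite_E: "finite E"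
proof -
  interpret pair_graph "complement_graph Y"
    by (rule pair_graph_complement_graph[OF pair_graph_Y])
  show "sym E" by (auto intro: symI arcs_symmetric)
  show "finite E" by simp
qed

text \<open>
  Positions run from 1 to \<open>n\<close>, so they represent each residue class modulo \<open>n\<close> exactly once,
  with \<open>n\<close> in place of 0.
\<close>

lemma mod_eq_imp_eq:
  assumes "i \<in> {1..n}" "j \<in> {1..n}" "int i mod int n = int j mod int n"
  shows "i = j"
proof -
  have "i mod n = j mod n" using assms(3) by (metis of_nat_eq_iff zmod_int)
  moreover have "k mod n = (if k = n then 0 else k)" if "k \<in> {1..n}" for k using that by auto
  ultimately show ?thesis using assms(1,2) by (auto split: if_splits)
qed

text \<open>
  In terms of residues the wrap-around edge \<open>{n, 1}\<close> is like all the others.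
\<close>

lemma cycle_arcs:
  "(i, j) \<in> parcs X \<longleftrightarrow> i \<in> {1..n} \<and> j \<in> {1..n} \<and>
     (int j mod int n = (int i + 1) mod int n \<or> int i mod int n = (int j + 1) mod int n)"
proof -
  have *: "int j mod int n = (int i + 1) mod int n \<longleftrightarrow> j = (if i = n then 1 else i + 1)"
    if ij: "i \<in> {1..n}" "j \<in> {1..n}" for i j
  proof -
    let ?s = "if i = n then 1 else i + 1"
    have s: "?s \<in> {1..n}" using ij by auto
    have "(int i + 1) mod int n = int ?s mod int n" by (auto simp: add.commute)
    then show ?thesis using mod_eq_imp_eq[OF ij(2) s] by auto
  qed
  define F where "F = {(i, i + 1) | i. 1 \<le> i \<and> i \<le> n - 1} \<union> {(n, 1 :: nat)}"
  have F: "(i, j) \<in> F \<longleftrightarrow> i \<in> {1..n} \<and> j \<in> {1..n} \<and> j = (if i = n then 1 else i + 1)" for i j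
    using n_ge_3 by (cases "i = n") (auto simp: F_def)
  have "(i, j) \<in> parcs X \<longleftrightarrow> (i, j) \<in> F \<or> (j, i) \<in> F"
    by (simp add: cycle_graph_def Let_def F_def)
  then show ?thesis using F[of i j] F[of j i] *[of i j] *[of j i] by metis
qed

lemma ex_position:
  assumes "lifts p \<sigma>" "v \<in> V"
  obtains i where "i \<in> {1..n}" "\<sigma> i = v" "p v mod int n = int i mod int n"
proof -
  have "v \<in> \<sigma> ` {1..n}" using assms by (auto simp: lifts_def FS_verts bij_betw_def)
  then show ?thesis using assms(1) that by (auto simp: lifts_def)
qed

lemma lifts_inj:
  assumes "lifts p \<sigma>" "u \<in> V" "v \<in> V" "p u mod int n = p v mod int n"
  shows "u = v"
proof -
  obtain i where i: "i \<in> {1..n}" "\<sigma> i = u" "p u mod int n = int i mod int n"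
    using ex_position[OF assms(1,2)] .
  obtain j where j: "j \<in> {1..n}" "\<sigma> j = v" "p v mod int n = int j mod int n"
    using ex_position[OF assms(1,3)] .
  have "i = j" using mod_eq_imp_eq[OF i(1) j(1)] i(3) j(3) assms(4) by simp
  then show ?thesis using i(2) j(2) by simp
qed

lemma lifts_cong:
  assumes "lifts p \<sigma>" "lifts q \<tau>" "\<And>v. v \<in> V \<Longrightarrow> p v mod int n = q v mod int n"
  shows "\<sigma> = \<tau>"
proof
  fix i
  show "\<sigma> i = \<tau> i"
  proof (cases "i \<in> {1..n}")
    case True
    then have v: "\<sigma> i \<in> V" using assms(1) by (auto simp: lifts_def FS_verts)
    from ex_position[OF assms(2) v] obtain j where j: "j \<in> {1..n}" "\<tau> j = \<sigma> i"
      "q (\<sigma> i) mod int n = int j mod int n" by auto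
    then have "int i mod int n = int j mod int n"
      using assms(1,3) v True by (metis lifts_def)
    then show ?thesis using mod_eq_imp_eq True j by metis
  next
    case False
    then have "\<sigma> i = undefined" "\<tau> i = undefined"
      using assms(1,2) unfolding lifts_def FS_verts by (blast intro: PiE_arb)+
    then show ?thesis by simp
  qed
qed

lemma lifts_eq_mod:
  assumes "lifts p \<sigma>" "lifts q \<sigma>" "v \<in> V"
  shows "p v mod int n = q v mod int n"
proof -
  obtain i where "i \<in> {1..n}" "\<sigma> i = v" using ex_position[OF assms(1,3)] .
  with assms show ?thesis by (auto simp: lifts_def)
qed

lemma ex_lift:
  assumes "\<sigma> \<in> pverts (FS X Y)"
  obtains p where "lifts p \<sigma>"
proof
  show "lifts (\<lambda>v. int (inv_into {1..n} \<sigma> v)) \<sigma>"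
    using assms by (auto simp: lifts_def FS_verts bij_betw_def inv_into_f_f)
qed

text \<open>
  A function that is injective modulo \<open>n\<close> on \<open>n\<close> people hits every residue class, by counting.
\<close>

lemma ex_arrangement:
  assumes "inj_on (\<lambda>v. p v mod int n) V"
  obtains \<sigma> where "lifts p \<sigma>"
proof -
  define r where "r v = p v mod int n" for v
  have "r ` V = {0..<int n}"
    using assms n_ge_3 card_Y
    by (intro card_subset_eq) (auto simp: card_image r_def)
  then have ex: "\<exists>v\<in>V. r v = int i mod int n" for i :: nat
    using n_ge_3 by (metis atLeastLessThan_iff imageE of_nat_0_less_iff pos_mod_bound pos_mod_sign
        order.strict_trans2 zero_less_numeral)
  define \<sigma> where "\<sigma> = (\<lambda>i\<in>{1..n}. SOME v. v \<in> V \<and> r v = int i mod int n)"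
  have \<sigma>: "\<sigma> i \<in> V \<and> r (\<sigma> i) = int i mod int n" if "i \<in> {1..n}" for i
    using someI_ex[of "\<lambda>v. v \<in> V \<and> r v = int i mod int n"] ex[of i] that
    by (auto simp: \<sigma>_def)
  have inj: "inj_on \<sigma> {1..n}"
    by (rule inj_onI) (metis \<sigma> mod_eq_imp_eq)
  then have "\<sigma> ` {1..n} = V"
    using \<sigma> finite_V card_Y by (intro card_subset_eq) (auto simp: card_image)
  with inj \<sigma> have "lifts p \<sigma>"
    by (auto simp: lifts_def FS_verts bij_betw_def r_def \<sigma>_def)
  then show ?thesis by (rule that)
qed

section \<open>Swaps preserve the sum and the windows\<close>

lemma sum_shift:
  assumes "x \<in> V" "y \<in> V" "x \<noteq> y"
  shows "sum (shift x y p) V = sum p V"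
proof -
  have V: "V = insert x (insert y (V - {x, y}))" using assms by auto
  have "sum (shift x y p) (V - {x, y}) = sum p (V - {x, y})"
    by (rule sum.cong) (auto simp: shift_def)
  then have "sum (shift x y p) (insert x (insert y (V - {x, y}))) = sum p (insert x (insert y (V - {x, y})))"
    using assms finite_V by (simp add: shift_def)
  with V show ?thesis by simp
qed

lemma same_windows_sym: "same_windows p q \<Longrightarrow> same_windows q p"
  by (auto simp: same_windows_def)

lemma same_windows_trans: "same_windows p q \<Longrightarrow> same_windows q r \<Longrightarrow> same_windows p r"
  by (fastforce simp: same_windows_def)

text \<open>
  A step by 1 can change the quotient of \<open>p u - p v\<close> by \<open>n\<close> only if \<open>u\<close> and \<open>v\<close> are
  congruent before the step (when the difference goes down) or would be congruent after it (when it
  goes up). The first never happens since positions are distinct, and the second only happens if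
  \<open>u\<close> and \<open>v\<close> are the two people swapped, who are not strangers.
\<close>

lemma same_windows_shift:
  assumes p: "lifts p \<sigma>" and xy: "x \<in> V" "y \<in> V" "(x, y) \<in> parcs Y"
    and adj: "p y mod int n = (p x + 1) mod int n"
  shows "same_windows p (shift x y p)"
proof -
  have n0: "int n > 0" using n_ge_3 by simp
  have "x \<noteq> y" using pair_graph_Y xy by (auto simp: pair_graph_iff irrefl_def)
  have yx: "(y, x) \<in> parcs Y" using pair_graph_Y xy by (auto simp: pair_graph_iff dest: symD)
  have X: "\<not> int n dvd p x - p v + 1" if "v \<in> V" "v \<noteq> y" for v
  proof
    assume "int n dvd p x - p v + 1"
    then have "(p x + 1) mod int n = p v mod int n"
      by (simp add: mod_eq_dvd_iff algebra_simps)
    with adj lifts_inj[OF p xy(2) that(1)] that(2) show False by simp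
  qed
  have Y: "\<not> int n dvd p v - p y + 1" if "v \<in> V" "v \<noteq> x" for v
  proof
    assume *: "int n dvd p v - p y + 1"
    have "int n dvd p y - (p x + 1)" using adj by (simp add: mod_eq_dvd_iff)
    with * have "int n dvd (p v - p y + 1) + (p y - (p x + 1))" by (rule dvd_add)
    then have "p v mod int n = p x mod int n" by (simp add: mod_eq_dvd_iff)
    with lifts_inj[OF p that(1) xy(1)] that(2) show False by simp
  qed
  have D: "\<not> int n dvd p u - p v" if "u \<in> V" "v \<in> V" "u \<noteq> v" for u v
    using lifts_inj[OF p that(1,2)] that(3) by (auto simp: mod_eq_dvd_iff)
  show ?thesis
    unfolding same_windows_def
  proof safe
    fix u v assume "(u, v) \<in> E"
    then have uv: "u \<in> V" "v \<in> V" "u \<noteq> v" "(u, v) \<notin> parcs Y" by (auto simp: E_iff)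
    have D': "(p u - p v - 1) div int n = (p u - p v) div int n"
      using zdiv_add_one_eq[OF n0, of "p u - p v - 1"] D[OF uv(1-3)] by simp
    consider "u \<notin> {x, y}" "v \<notin> {x, y}" | "u = y" "v \<notin> {x, y}" | "v = x" "u \<notin> {x, y}"
      | "u = x" "v \<notin> {x, y}" | "v = y" "u \<notin> {x, y}"
      using uv xy yx by auto
    then show "(p u - p v) div int n = (shift x y p u - shift x y p v) div int n"
    proof cases
      case 4
      then show ?thesis using zdiv_add_one_eq[OF n0 X[of v]] uv \<open>x \<noteq> y\<close>
        by (auto simp: shift_def algebra_simps)
    next
      case 5
      then show ?thesis using zdiv_add_one_eq[OF n0 Y[of u]] uv \<open>x \<noteq> y\<close>
        by (auto simp: shift_def algebra_simps)
    qed (use D' \<open>x \<noteq> y\<close> in \<open>auto simp: shift_def algebra_simps\<close>)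
  qed
qed

lemma swap_lift:
  assumes p: "lifts p \<sigma>" and ij: "i \<in> {1..n}" "j \<in> {1..n}"
    and adj: "int j mod int n = (int i + 1) mod int n"
    and friends: "(\<sigma> i, \<sigma> j) \<in> parcs Y"
  defines "\<tau> \<equiv> \<sigma>(i := \<sigma> j, j := \<sigma> i)" and "q \<equiv> shift (\<sigma> i) (\<sigma> j) p"
  shows "(\<sigma>, \<tau>) \<in> parcs (FS X Y)" "lifts q \<tau>" "sum q V = sum p V" "same_windows p q"
proof -
  have \<sigma>: "\<sigma> \<in> {1..n} \<rightarrow>\<^sub>E V" "inj_on \<sigma> {1..n}" "\<sigma> ` {1..n} = V"
    using p by (auto simp: lifts_def FS_verts bij_betw_def)
  have V: "\<sigma> i \<in> V" "\<sigma> j \<in> V" using \<sigma>(3) ij by blast+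
  have ne: "\<sigma> i \<noteq> \<sigma> j" using pair_graph_Y friends by (auto simp: pair_graph_iff irrefl_def)
  then have "i \<noteq> j" by auto
  have pos: "p (\<sigma> c) mod int n = int c mod int n" if "c \<in> {1..n}" for c
    using p that by (simp add: lifts_def)
  have "\<tau> c \<in> \<sigma> ` {1..n}" if "c \<in> {1..n}" for c
    using that ij by (auto simp: \<tau>_def)
  moreover have "\<sigma> c \<in> \<tau> ` {1..n}" if "c \<in> {1..n}" for c
    using that ij \<open>i \<noteq> j\<close>
    by (intro image_eqI[of _ _ "if c = i then j else if c = j then i else c"]) (auto simp: \<tau>_def)
  ultimately have "\<tau> ` {1..n} = \<sigma> ` {1..n}" by blast
  then have "\<tau> ` {1..n} = V" using \<sigma>(3) by simp
  moreover have "inj_on \<tau> {1..n}"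
    using \<open>\<tau> ` {1..n} = V\<close> card_Y by (intro eq_card_imp_inj_on) auto
  moreover have "\<tau> \<in> extensional {1..n}"
    using \<sigma>(1) ij by (auto simp: \<tau>_def extensional_def)
  ultimately have \<tau>: "\<tau> \<in> pverts (FS X Y)"
    by (auto simp: FS_verts bij_betw_def PiE_def)
  have "(i, j) \<in> parcs X" using ij adj by (simp add: cycle_arcs)
  then show "(\<sigma>, \<tau>) \<in> parcs (FS X Y)"
    using \<tau> p friends \<open>i \<noteq> j\<close> unfolding FS_arcs lifts_def
    by (intro conjI exI[of _ i] exI[of _ j]) (auto simp: \<tau>_def)
  have "q (\<tau> c) mod int n = int c mod int n" if c: "c \<in> {1..n}" for c
  proof -
    consider "c = i" | "c = j" | "c \<noteq> i" "c \<noteq> j" by blast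
    then show ?thesis
    proof cases
      case 1
      have "q (\<tau> c) mod int n = (p (\<sigma> j) - 1) mod int n"
        using 1 ne \<open>i \<noteq> j\<close> by (simp add: q_def \<tau>_def shift_def)
      also have "\<dots> = (int i + 1 - 1) mod int n"
        using pos[OF ij(2)] adj by (intro mod_diff_cong) simp_all
      finally show ?thesis using 1 by simp
    next
      case 2
      have "q (\<tau> c) mod int n = (p (\<sigma> i) + 1) mod int n"
        using 2 ne by (simp add: q_def \<tau>_def shift_def)
      also have "\<dots> = (int i + 1) mod int n"
        using pos[OF ij(1)] by (intro mod_add_cong) simp_all
      finally show ?thesis using 2 adj by simp
    next
      case 3
      then have "\<sigma> c \<noteq> \<sigma> i" "\<sigma> c \<noteq> \<sigma> j" using \<sigma>(2) c ij by (auto dest: inj_onD)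
      then show ?thesis using 3 pos[OF c] by (simp add: q_def \<tau>_def shift_def)
    qed
  qed
  with \<tau> show "lifts q \<tau>" by (simp add: lifts_def)
  show "sum q V = sum p V" unfolding q_def using V ne by (rule sum_shift)
  have "p (\<sigma> j) mod int n = (p (\<sigma> i) + 1) mod int n"
    using pos[OF ij(2)] adj mod_add_cong[OF pos[OF ij(1)] refl, of 1] by simp
  then show "same_windows p q"
    unfolding q_def using p V friends by (intro same_windows_shift) auto
qed

text \<open>
  The edge of the cycle on which a swap takes place can be traversed in either direction, and one of
  them makes the second end the successor of the first.
\<close>

lemma lift_step:
  assumes p: "lifts p \<sigma>" and step: "(\<sigma>, \<tau>) \<in> parcs (FS X Y)"
  shows "\<exists>q. lifts q \<tau> \<and> sum q V = sum p V \<and> same_windows p q"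
proof -
  obtain i j where ij: "(i, j) \<in> parcs X" "(\<sigma> i, \<sigma> j) \<in> parcs Y" "\<sigma> i = \<tau> j" "\<sigma> j = \<tau> i"
    "\<forall>c \<in> {1..n} - {i, j}. \<sigma> c = \<tau> c" and \<sigma>\<tau>: "\<sigma> \<in> pverts (FS X Y)" "\<tau> \<in> pverts (FS X Y)"
    using step by (auto simp: FS_arcs)
  have \<tau>: "\<tau> = \<sigma>(i := \<sigma> j, j := \<sigma> i)"
  proof
    fix c
    consider "c \<in> {i, j}" | "c \<in> {1..n} - {i, j}" | "c \<notin> {1..n}" "c \<notin> {i, j}" by blast
    then show "\<tau> c = (\<sigma>(i := \<sigma> j, j := \<sigma> i)) c"
    proof cases
      case 2
      with ij(5) show ?thesis by simp
    next
      case 3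
      then have "\<sigma> c = undefined" "\<tau> c = undefined"
        using \<sigma>\<tau> unfolding FS_verts by (blast intro: PiE_arb)+
      with 3 show ?thesis by simp
    qed (use ij in auto)
  qed
  have range: "i \<in> {1..n}" "j \<in> {1..n}" using ij(1) by (auto simp: cycle_arcs)
  have "int j mod int n = (int i + 1) mod int n \<or> int i mod int n = (int j + 1) mod int n"
    using ij(1) by (simp add: cycle_arcs)
  then show ?thesis
  proof
    assume "int j mod int n = (int i + 1) mod int n"
    from swap_lift[OF p range this ij(2)] \<tau> show ?thesis by auto
  next
    assume adj: "int i mod int n = (int j + 1) mod int n"
    have "(\<sigma> j, \<sigma> i) \<in> parcs Y" using ij(2) pair_graph_Y by (auto simp: pair_graph_iff dest: symD)
    moreover have "\<tau> = \<sigma>(j := \<sigma> i, i := \<sigma> j)" using \<tau> by (auto simp: fun_eq_iff)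
    ultimately show ?thesis using swap_lift[OF p range(2,1) adj] by auto
  qed
qed

lemma lift_path:
  assumes "(\<sigma>, \<tau>) \<in> (parcs (FS X Y))\<^sup>*" "lifts p \<sigma>"
  shows "\<exists>q. lifts q \<tau> \<and> sum q V = sum p V \<and> same_windows p q"
  using assms(1)
proof induction
  case base
  show ?case using assms(2) by (intro exI[of _ p]) (simp add: same_windows_def)
next
  case (step \<tau> \<tau>')
  then obtain q where q: "lifts q \<tau>" "sum q V = sum p V" "same_windows p q" by blast
  from lift_step[OF q(1) step.hyps(2)] q(2,3) show ?case
    by (metis same_windows_trans)
qed

section \<open>The invariants are complete\<close>

text \<open>
  A function that never decreases from one position to the next, also not across the wrap-around, is
  constant.
\<close>

lemma cyclic_descent:
  fixes f :: "nat \<Rightarrow> int"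
  assumes i: "i \<in> {1..n}" and ne: "f i \<noteq> f 1"
  shows "\<exists>j\<in>{1..n}. \<exists>k\<in>{1..n}. int k mod int n = (int j + 1) mod int n \<and> f k < f j"
proof (rule ccontr)
  assume contra: "\<not> ?thesis"
  have Suc_le: "f j \<le> f (Suc j)" if "1 \<le> j" "j < n" for j
    using contra[simplified, rule_format, of j "Suc j"] that by (simp add: add.commute not_less)
  have mono: "f j \<le> f k" if "1 \<le> j" "j \<le> k" "k \<le> n" for j k
    using that(2,3,1)
  proof (induction k rule: dec_induct)
    case (step k)
    with Suc_le[of k] show ?case by simp
  qed simp
  have "f n \<le> f 1"
    using contra[simplified, rule_format, of n 1] n_ge_3 by (simp add: not_less)
  with mono[of 1 i] mono[of i n] i ne show False by simp
qed

text \<open>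
  Let \<open>d v = q v - p v\<close>. If \<open>d\<close> is constant, equality of the sums makes it 0. Otherwise some
  \<open>x\<close> directly precedes some \<open>y\<close> on the cycle and has \<open>d y < d x\<close>. The gap cannot be 1, since
  \<open>x\<close> and \<open>y\<close> would then have the same position in \<open>\<tau>\<close>; so it is at least 2. Hence
  \<open>y\<close>, which up to full turns is one step ahead of \<open>x\<close> in \<open>p\<close>, has fallen behind it in \<open>q\<close>. The
  windows exclude this for strangers, so \<open>x\<close> and \<open>y\<close> can be swapped. This replaces \<open>d x\<close> and \<open>d y\<close> by
  \<open>d x - 1\<close> and \<open>d y + 1\<close>, which are closer together.
\<close>

lemma connected_if_same_sum_same_windows:
  assumes "lifts p \<sigma>" "lifts q \<tau>" "sum p V = sum q V" "same_windows p q"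
  shows "(\<sigma>, \<tau>) \<in> (parcs (FS X Y))\<^sup>*"
  using assms
proof (induction "nat (\<Sum>v\<in>V. (q v - p v)\<^sup>2)" arbitrary: p \<sigma> rule: less_induct)
  case less
  define d where "d v = q v - p v" for v
  have \<sigma>: "\<sigma> \<in> {1..n} \<rightarrow>\<^sub>E V" "inj_on \<sigma> {1..n}" "\<sigma> ` {1..n} = V"
    using less.prems(1) by (auto simp: lifts_def FS_verts bij_betw_def)
  show ?case
  proof (cases "\<forall>i\<in>{1..n}. d (\<sigma> i) = d (\<sigma> 1)")
    case True
    then have const: "d v = d (\<sigma> 1)" if "v \<in> V" for v using that \<sigma>(3) by (metis imageE)
    have "0 = (\<Sum>v\<in>V. d v)" using less.prems(3) by (simp add: d_def sum_subtractf)
    also have "\<dots> = int n * d (\<sigma> 1)" using const card_Y by simp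
    finally have "d (\<sigma> 1) = 0" using n_ge_3 by simp
    then have "\<sigma> = \<tau>"
      using const by (intro lifts_cong[OF less.prems(1,2)]) (simp add: d_def)
    then show ?thesis by simp
  next
    case False
    then obtain i where "i \<in> {1..n}" "d (\<sigma> i) \<noteq> d (\<sigma> 1)" by blast
    from cyclic_descent[of i "\<lambda>i. d (\<sigma> i)", OF this]
    obtain i j where ij: "i \<in> {1..n}" "j \<in> {1..n}" "int j mod int n = (int i + 1) mod int n"
      and "d (\<sigma> j) < d (\<sigma> i)"
      by blast
    define x y where "x = \<sigma> i" and "y = \<sigma> j"
    have xy: "x \<in> V" "y \<in> V" "d y < d x"
      using \<sigma>(3) ij \<open>d (\<sigma> j) < d (\<sigma> i)\<close> by (auto simp: x_def y_def)
    then have "x \<noteq> y" by auto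
    have "p y mod int n = int j mod int n" "p x mod int n = int i mod int n"
      using less.prems(1) ij by (auto simp: lifts_def x_def y_def)
    then have "p y mod int n = (p x + 1) mod int n"
      using ij(3) mod_add_cong[of "p x" "int n" "int i" 1 1] by simp
    then obtain m where m: "p y = p x + 1 + int n * m"
      by (metis mod_eq_dvd_iff dvd_def diff_eq_eq add.commute)
    have gap: "q y - q x = int n * m + (d y - d x + 1)" using m by (simp add: d_def)
    have "d x - d y \<noteq> 1"
    proof
      assume "d x - d y = 1"
      then have "q y = q x + int n * m" using gap by simp
      then have "q y mod int n = q x mod int n" by simp
      with lifts_inj[OF less.prems(2) xy(2,1)] \<open>x \<noteq> y\<close> show False by simp
    qed
    then have d2: "d x - d y \<ge> 2" using xy(3) by linarith
    have "(x, y) \<in> parcs Y"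
    proof (rule ccontr)
      assume "(x, y) \<notin> parcs Y"
      then have "(y, x) \<in> E" using xy \<open>x \<noteq> y\<close> sym_E by (auto simp: E_iff dest: symD)
      then have "(p y - p x) div int n = (q y - q x) div int n"
        using less.prems(4) by (auto simp: same_windows_def)
      moreover have "(p y - p x) div int n = m"
        using n_ge_3 m by (simp add: add.commute)
      moreover have "(q y - q x) div int n < m"
      proof -
        have "(q y - q x) div int n = m + (d y - d x + 1) div int n"
          using n_ge_3 unfolding gap by simp
        moreover have "(d y - d x + 1) div int n < 0"
          using n_ge_3 d2 by (intro div_neg_pos_less0) auto
        ultimately show ?thesis by simp
      qed
      ultimately show False by simp
    qed
    then have friends: "(\<sigma> i, \<sigma> j) \<in> parcs Y" by (simp add: x_def y_def)
    define p' \<sigma>' where "p' = shift x y p" and "\<sigma>' = \<sigma>(i := \<sigma> j, j := \<sigma> i)"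
    note swap = swap_lift[OF less.prems(1) ij friends, folded \<sigma>'_def x_def y_def, folded p'_def]
    have "(\<Sum>v\<in>V. (q v - p' v)\<^sup>2) < (\<Sum>v\<in>V. (q v - p v)\<^sup>2)"
    proof -
      have split: "(\<Sum>v\<in>V. g v) = g x + g y + (\<Sum>v\<in>V - {x, y}. g v)" for g :: "'a \<Rightarrow> int"
      proof -
        have "V = insert x (insert y (V - {x, y}))" using xy by auto
        then have "sum g V = sum g (insert x (insert y (V - {x, y})))" by simp
        then show ?thesis using finite_V \<open>x \<noteq> y\<close> by simp
      qed
      have "(\<Sum>v\<in>V - {x, y}. (q v - p' v)\<^sup>2) = (\<Sum>v\<in>V - {x, y}. (q v - p v)\<^sup>2)"
        by (rule sum.cong) (auto simp: p'_def shift_def)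
      moreover have "(q x - p' x)\<^sup>2 + (q y - p' y)\<^sup>2 = (d x - 1)\<^sup>2 + (d y + 1)\<^sup>2"
        using \<open>x \<noteq> y\<close> by (simp add: p'_def shift_def d_def algebra_simps)
      moreover have "(d x - 1)\<^sup>2 + (d y + 1)\<^sup>2 = (d x)\<^sup>2 + (d y)\<^sup>2 - 2 * (d x - d y) + 2"
        by (simp add: power2_eq_square algebra_simps)
      ultimately show ?thesis
        using split[of "\<lambda>v. (q v - p' v)\<^sup>2"] split[of "\<lambda>v. (q v - p v)\<^sup>2"] d2
        by (simp add: d_def)
    qed
    moreover have "0 \<le> (\<Sum>v\<in>V. (q v - p' v)\<^sup>2)" by (simp add: sum_nonneg)
    ultimately have "nat (\<Sum>v\<in>V. (q v - p' v)\<^sup>2) < nat (\<Sum>v\<in>V. (q v - p v)\<^sup>2)" by linarith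
    then have "(\<sigma>', \<tau>) \<in> (parcs (FS X Y))\<^sup>*"
    proof (rule less.hyps)
      show "sum p' V = sum q V" using swap(3) less.prems(3) by simp
      show "same_windows p' q"
        using same_windows_trans[OF same_windows_sym[OF swap(4)] less.prems(4)] .
    qed (rule swap(2), rule less.prems(2))
    with swap(1) show ?thesis by (rule converse_rtrancl_into_rtrancl)
  qed
qed

section \<open>A connected swap graph forces a forest of strangers\<close>

lemma ex_arrangement_of_list:
  assumes "distinct zs" "set zs = V"
  obtains p \<sigma> where "lifts p \<sigma>" "\<And>i. i < length zs \<Longrightarrow> p (zs ! i) = int i"
proof -
  have len: "length zs = n" using assms card_Y by (metis distinct_card)
  define p where "p v = int (inv_into {..<n} ((!) zs) v)" for v
  have inj: "inj_on ((!) zs) {..<n}" using assms(1) len by (auto simp: inj_on_def nth_eq_iff_index_eq)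
  then have p: "p (zs ! i) = int i" if "i < length zs" for i
    using that len by (simp add: p_def inv_into_f_f)
  have "inj_on (\<lambda>v. p v mod int n) V"
  proof (rule inj_onI)
    fix u v assume "u \<in> V" "v \<in> V" and eq: "p u mod int n = p v mod int n"
    then obtain i j where "i < n" "j < n" "u = zs ! i" "v = zs ! j"
      using assms(2) len by (metis in_set_conv_nth)
    with eq p len show "u = v" by simp
  qed
  from ex_arrangement[OF this] p that show ?thesis by blast
qed

text \<open>
  Used with \<open>r\<close> a lift chosen by hand and \<open>q\<close> the lift of the same arrangement that a path of
  swaps produces: the windows then determine how \<open>k\<close> varies along an edge.
\<close>

lemma same_windows_translated:
  assumes pq: "same_windows p q" and E: "(u, v) \<in> E"
    and q: "q u = r u + int n * k u" "q v = r v + int n * k v"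
  shows "(p u - p v) div int n = (r u - r v) div int n + k u - k v"
proof -
  have "q u - q v = (r u - r v) + int n * (k u - k v)" using q by (simp add: algebra_simps)
  then have "(q u - q v) div int n = (k u - k v) + (r u - r v) div int n"
    using n_ge_3 by simp
  with pq E show ?thesis by (auto simp: same_windows_def)
qed

lemma ex_translation:
  assumes "lifts p \<sigma>" "lifts q \<sigma>"
  obtains k where "\<And>v. v \<in> V \<Longrightarrow> q v = p v + int n * k v"
proof
  fix v assume "v \<in> V"
  then have "int n dvd q v - p v" using lifts_eq_mod[OF assms] by (metis mod_eq_dvd_iff)
  then have "int n * ((q v - p v) div int n) = q v - p v" by simp
  then show "q v = p v + int n * ((q v - p v) div int n)" by linarith
qed

text \<open>
  Start from the cycle placed on the first positions in order, and end with the same positions in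
  reverse order. Along every edge of the path \<open>xs\<close> the next person stays ahead, by less than a full
  turn. In the reversed arrangement, where the next person stands one position back, this means
  \<open>n - 1\<close> steps ahead. So the last person ends up \<open>(n - 1) * l\<close> ahead of the first one, where
  \<open>l \<ge> 2\<close> is the number of edges of the path, although the closing edge allows less than
  \<open>n\<close>.
\<close>

lemma no_long_stranger_cycle:
  assumes conn: "\<And>\<sigma> \<tau>. \<sigma> \<in> pverts (FS X Y) \<Longrightarrow> \<tau> \<in> pverts (FS X Y) \<Longrightarrow> (\<sigma>, \<tau>) \<in> (parcs (FS X Y))\<^sup>*"
    and xs: "distinct xs" "length xs \<ge> 3"
    and edges: "\<And>i. Suc i < length xs \<Longrightarrow> (xs ! i, xs ! Suc i) \<in> E"
    and closing: "(last xs, hd xs) \<in> E"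
  shows False
proof -
  \<comment> \<open>the last index of the list, that is, the number of edges without the closing one\<close>
  define l where "l = length xs - 1"
  have len: "length xs = Suc l" and l2: "l \<ge> 2" using xs(2) by (auto simp: l_def)
  have "xs \<noteq> []" using xs(2) by auto
  have V: "xs ! i \<in> V" if "i \<le> l" for i
  proof (cases "i = l")
    case True
    then show ?thesis
      using closing \<open>xs \<noteq> []\<close> by (simp add: E_iff last_conv_nth l_def)
  next
    case False
    with that edges[of i] show ?thesis by (simp add: E_iff len)
  qed
  then have "set xs \<subseteq> V" by (auto simp: in_set_conv_nth len)
  \<comment> \<open>everybody off the cycle keeps the same position in both arrangements\<close>
  obtain ys where ys: "distinct ys" "set ys = V - set xs"
    using finite_distinct_list[of "V - set xs"] finite_V by auto
  have "length (xs @ ys) = n"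
    using ys xs(1) \<open>set xs \<subseteq> V\<close> card_Y distinct_card[of "xs @ ys"] by (auto simp: Un_absorb1)
  then have ln: "Suc l \<le> n" using len by simp
  have zs: "distinct (xs @ ys)" "set (xs @ ys) = V" "distinct (rev xs @ ys)" "set (rev xs @ ys) = V"
    using ys xs(1) \<open>set xs \<subseteq> V\<close> by auto
  obtain p \<sigma> where p: "lifts p \<sigma>" "\<And>i. i < length (xs @ ys) \<Longrightarrow> p ((xs @ ys) ! i) = int i"
    using ex_arrangement_of_list[OF zs(1,2)] by blast
  obtain r \<tau> where r: "lifts r \<tau>" "\<And>i. i < length (rev xs @ ys) \<Longrightarrow> r ((rev xs @ ys) ! i) = int i"
    using ex_arrangement_of_list[OF zs(3,4)] by blast
  have p_nth: "p (xs ! i) = int i" if "i \<le> l" for i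
    using p(2)[of i] that len by (simp add: nth_append)
  have r_nth: "r (xs ! i) = int l - int i" if "i \<le> l" for i
  proof -
    have "(rev xs @ ys) ! (l - i) = xs ! i" using that len by (simp add: nth_append rev_nth less_Suc_eq_le)
    then show ?thesis using r(2)[of "l - i"] that len by (simp add: of_nat_diff)
  qed
  have "(\<sigma>, \<tau>) \<in> (parcs (FS X Y))\<^sup>*" using p r by (intro conn) (auto simp: lifts_def)
  from lift_path[OF this p(1)] obtain q where q: "lifts q \<tau>" "same_windows p q" by blast
  obtain k where k: "\<And>v. v \<in> V \<Longrightarrow> q v = r v + int n * k v"
    using ex_translation[OF r(1) q(1)] by blast
  have step: "k (xs ! Suc i) = k (xs ! i) + 1" if "Suc i \<le> l" for i
  proof -
    have "(p (xs ! i) - p (xs ! Suc i)) div int n =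
      (r (xs ! i) - r (xs ! Suc i)) div int n + k (xs ! i) - k (xs ! Suc i)"
      using that edges[of i] k V len by (intro same_windows_translated[OF q(2)]) auto
    moreover have "p (xs ! i) - p (xs ! Suc i) = - 1" "r (xs ! i) - r (xs ! Suc i) = 1"
      using p_nth[of i] p_nth[of "Suc i"] r_nth[of i] r_nth[of "Suc i"] that by simp_all
    moreover have "(- 1) div int n = - 1" "1 div int n = 0"
      using n_ge_3 by (simp_all add: zdiv_eq_0_iff div_eq_minus1)
    ultimately show ?thesis by simp
  qed
  have K: "k (xs ! i) = k (xs ! 0) + int i" if "i \<le> l" for i
    using that
  proof (induction i)
    case (Suc i)
    with step[of i] show ?case by simp
  qed simp
  have "(xs ! l, xs ! 0) \<in> E"
    using closing \<open>xs \<noteq> []\<close> by (simp add: last_conv_nth hd_conv_nth l_def)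
  then have "(p (xs ! l) - p (xs ! 0)) div int n = (q (xs ! l) - q (xs ! 0)) div int n"
    using q(2) by (auto simp: same_windows_def)
  moreover have "(p (xs ! l) - p (xs ! 0)) div int n = 0"
    using p_nth[of l] p_nth[of 0] ln by simp
  ultimately have "(q (xs ! l) - q (xs ! 0)) div int n = 0" by simp
  then have "q (xs ! l) - q (xs ! 0) < int n"
    using n_ge_3 pos_imp_zdiv_pos_iff[of "int n" "q (xs ! l) - q (xs ! 0)"] by simp
  moreover have "q (xs ! l) - q (xs ! 0) = (int n - 1) * int l"
    using k[OF V[of l]] k[OF V[of 0]] r_nth[of l] r_nth[of 0] K[of l] by (simp add: algebra_simps)
  moreover have "(int n - 1) * int l \<ge> (int n - 1) * 2"
    using l2 n_ge_3 by (intro mult_left_mono) auto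
  ultimately have "(int n - 1) * 2 < int n" by simp
  then show False using n_ge_3 by simp
qed

lemma pcas_nth_Suc:
  "pcas u c v \<Longrightarrow> Suc i < length c \<Longrightarrow> fst (c ! Suc i) = snd (c ! i)"
proof (induction c arbitrary: u i)
  case (Cons e c)
  then show ?case by (cases i; cases c) auto
qed simp

lemma pcas_ends: "pcas u c v \<Longrightarrow> c \<noteq> [] \<Longrightarrow> fst (hd c) = u \<and> snd (last c) = v"
  by (induction c arbitrary: u) auto

text \<open>
  The heads of the arcs of a closed walk list its vertices, beginning with the second one; the walk
  closes because the last head is the vertex from which the first arc starts.
\<close>

lemma connected_imp_forest:
  assumes conn: "\<And>\<sigma> \<tau>. \<sigma> \<in> pverts (FS X Y) \<Longrightarrow> \<tau> \<in> pverts (FS X Y) \<Longrightarrow> (\<sigma>, \<tau>) \<in> (parcs (FS X Y))\<^sup>*"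
  shows "undirected_forest (complement_graph Y)"
  unfolding undirected_forest_def
proof
  interpret C: pair_graph "complement_graph Y"
    by (rule pair_graph_complement_graph[OF pair_graph_Y])
  assume "\<exists>c. C.cycle c \<and> length c \<ge> 3"
  then obtain c u where c: "C.awalk u c u" "distinct (tl (C.awalk_verts u c))" "c \<noteq> []" "length c \<ge> 3"
    by (auto simp: C.cycle_def)
  have E: "set c \<subseteq> E" and cas: "pcas u c u" using c(1) by (auto simp: C.awalk_def)
  have "distinct (map snd c)" using c(2,3) C.awalk_verts_conv'[of u c u] cas by simp
  show False
  proof (rule no_long_stranger_cycle[OF conn \<open>distinct (map snd c)\<close>])
    fix i assume i: "Suc i < length (map snd c)"
    then have "c ! Suc i \<in> E" using E by auto
    moreover have "c ! Suc i = (map snd c ! i, map snd c ! Suc i)"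
      using i pcas_nth_Suc[OF cas, of i] by (simp add: prod_eq_iff)
    ultimately show "(map snd c ! i, map snd c ! Suc i) \<in> E" by simp
  next
    have "hd c \<in> E" using E c(3) by auto
    moreover have "hd c = (last (map snd c), hd (map snd c))"
      using pcas_ends[OF cas c(3)] c(3) by (simp add: prod_eq_iff last_map hd_map)
    ultimately show "(last (map snd c), hd (map snd c)) \<in> E" by simp
  qed (use c in auto)
qed

section \<open>Component sizes of the stranger graph\<close>

definition component_of :: "'a \<Rightarrow> 'a set" where
  "component_of = pre_digraph.scc_of (with_proj (complement_graph Y))"

text \<open>
  Passing from the induced subgraphs to their vertex sets makes the components the classes of a
  function on \<open>V\<close>, over which sums can be grouped.
\<close>

lemma Gcd_components:
  "(GCD T\<in>components (complement_graph Y). card (verts T)) = Gcd (card ` component_of ` V)"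
proof -
  interpret C: pair_graph "complement_graph Y"
    by (rule pair_graph_complement_graph[OF pair_graph_Y])
  have "verts ` C.sccs = component_of ` V"
    using C.sccs_verts_conv C.sccs_verts_conv_scc_of
    by (simp add: component_of_def complement_graph_def)
  then show ?thesis by (metis image_image)
qed

lemma component_of_edge: "(u, v) \<in> E \<Longrightarrow> component_of u = component_of v"
proof -
  interpret C: pair_graph "complement_graph Y"
    by (rule pair_graph_complement_graph[OF pair_graph_Y])
  assume "(u, v) \<in> E"
  then have "u \<in> C.scc_of v" by (intro C.scc_ofI_reachable C.reachable_adjI) simp
  then show ?thesis unfolding component_of_def by (rule C.scc_of_eq)
qed

lemma same_component_rtrancl:
  assumes "u \<in> component_of v"
  shows "(u, v) \<in> E\<^sup>*"
proof -
  interpret C: pair_graph "complement_graph Y"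
    by (rule pair_graph_complement_graph[OF pair_graph_Y])
  from assms have "u \<rightarrow>\<^sup>*\<^bsub>with_proj (complement_graph Y)\<^esub> v"
    by (simp add: component_of_def C.scc_of_def)
  then show ?thesis using reachable_rtranclI[of "with_proj (complement_graph Y)" u v] by simp
qed

lemma component_of_fibre:
  assumes "v \<in> V"
  shows "{u \<in> V. component_of u = component_of v} = component_of v"
proof -
  interpret C: pair_graph "complement_graph Y"
    by (rule pair_graph_complement_graph[OF pair_graph_Y])
  have V: "V = pverts (complement_graph Y)" by (simp add: complement_graph_def)
  have "u \<in> component_of v \<Longrightarrow> component_of u = component_of v" for u
    unfolding component_of_def by (rule C.scc_of_eq)
  moreover have "component_of v \<subseteq> V"
    unfolding component_of_def V C.scc_of_def using C.reachable_in_verts by auto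
  moreover have "u \<in> V \<Longrightarrow> u \<in> component_of u" for u
    unfolding component_of_def V using C.in_scc_of_self[of u] by simp
  ultimately show ?thesis by blast
qed

lemma sum_component_of:
  "(\<Sum>v\<in>V. f (component_of v)) = (\<Sum>S\<in>component_of ` V. f S * int (card S))"
proof -
  have "(\<Sum>v\<in>V. f (component_of v)) = (\<Sum>S\<in>component_of ` V. \<Sum>v | v \<in> V \<and> component_of v = S. f (component_of v))"
    using finite_V by (rule sum.image_gen)
  also have "\<dots> = (\<Sum>S\<in>component_of ` V. f S * int (card S))"
  proof (rule sum.cong[OF refl])
    fix S assume "S \<in> component_of ` V"
    then obtain v where "v \<in> V" "S = component_of v" by blast
    then have S: "{u \<in> V. component_of u = S} = S" using component_of_fibre by simp
    have "(\<Sum>v | v \<in> V \<and> component_of v = S. f (component_of v)) = (\<Sum>v | v \<in> V \<and> component_of v = S. f S)"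
      by (rule sum.cong) auto
    then show "(\<Sum>v | v \<in> V \<and> component_of v = S. f (component_of v)) = f S * int (card S)"
      by (simp add: S)
  qed
  finally show ?thesis .
qed

section \<open>A connected swap graph forces coprime component sizes\<close>

lemma ex_lifted_arrangement: obtains p \<sigma> where "lifts p \<sigma>"
  using finite_distinct_list[OF finite_V] ex_arrangement_of_list by metis

text \<open>
  The target is the arrangement in which everybody has moved one position forward. Its obvious lift
  \<open>r = p + 1\<close> has the windows of \<open>p\<close>, but its sum is larger by \<open>n\<close>; the lift \<open>q\<close> that a path of
  swaps produces must make up for this by full turns, which are constant on components.
\<close>

lemma connected_imp_Gcd:
  assumes conn: "\<And>\<sigma> \<tau>. \<sigma> \<in> pverts (FS X Y) \<Longrightarrow> \<tau> \<in> pverts (FS X Y) \<Longrightarrow> (\<sigma>, \<tau>) \<in> (parcs (FS X Y))\<^sup>*"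
  shows "Gcd (card ` component_of ` V) = 1"
proof -
  obtain p \<sigma> where p: "lifts p \<sigma>" by (rule ex_lifted_arrangement)
  define r where "r v = p v + 1" for v
  have "inj_on (\<lambda>v. r v mod int n) V"
    using lifts_inj[OF p] by (intro inj_onI) (auto simp: r_def mod_eq_dvd_iff)
  then obtain \<tau> where r: "lifts r \<tau>" by (rule ex_arrangement)
  have "(\<sigma>, \<tau>) \<in> (parcs (FS X Y))\<^sup>*" using p r by (intro conn) (auto simp: lifts_def)
  from lift_path[OF this p] obtain q where q: "lifts q \<tau>" "sum q V = sum p V" "same_windows p q"
    by blast
  obtain k where k: "\<And>v. v \<in> V \<Longrightarrow> q v = r v + int n * k v"
    using ex_translation[OF r q(1)] by blast
  have k_edge: "k u = k v" if "(u, v) \<in> E" for u v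
    using same_windows_translated[OF q(3) that, of r k] k that by (simp add: E_iff r_def)
  have k_path: "k u = k v" if "(u, v) \<in> E\<^sup>*" for u v
    using that by induction (auto dest: k_edge)
  define f where "f S = k (SOME v. v \<in> S)" for S
  have "k v = f (component_of v)" if "v \<in> V" for v
  proof -
    have "v \<in> component_of v" using component_of_fibre[OF that] that by blast
    then have "(SOME u. u \<in> component_of v) \<in> component_of v" by (rule someI)
    then show ?thesis unfolding f_def using same_component_rtrancl k_path by metis
  qed
  then have "(\<Sum>v\<in>V. k v) = (\<Sum>S\<in>component_of ` V. f S * int (card S))"
    using sum_component_of[of f] by simp
  moreover have "(\<Sum>v\<in>V. k v) = - 1"
  proof -
    have "sum q V = sum p V + int n * (1 + (\<Sum>v\<in>V. k v))"
      using k card_Y by (simp add: r_def sum.distrib sum_distrib_left algebra_simps)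
    then show ?thesis using q(2) n_ge_3 by simp
  qed
  moreover have "int (Gcd (card ` component_of ` V)) dvd (\<Sum>S\<in>component_of ` V. f S * int (card S))"
    by (intro dvd_sum dvd_mult) (auto intro: Gcd_dvd)
  ultimately have "int (Gcd (card ` component_of ` V)) dvd - 1" by metis
  then show ?thesis by simp
qed

section \<open>Coprime tree sizes suffice\<close>

lemma sum_lift_mod:
  assumes "lifts p \<sigma>"
  shows "sum p V mod int n = (\<Sum>i\<in>{1..n}. int i) mod int n"
proof -
  have \<sigma>: "bij_betw \<sigma> {1..n} V" and pos: "\<And>i. i \<in> {1..n} \<Longrightarrow> p (\<sigma> i) mod int n = int i mod int n"
    using assms by (auto simp: lifts_def FS_verts)
  have "sum p V = (\<Sum>i\<in>{1..n}. p (\<sigma> i))" using sum.reindex_bij_betw[OF \<sigma>, of p] by simp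
  also have "\<dots> mod int n = (\<Sum>i\<in>{1..n}. p (\<sigma> i) mod int n) mod int n" by (simp only: mod_sum_eq)
  also have "\<dots> = (\<Sum>i\<in>{1..n}. int i mod int n) mod int n" using pos by (metis (no_types, lifting) sum.cong)
  also have "\<dots> = (\<Sum>i\<in>{1..n}. int i) mod int n" by (simp only: mod_sum_eq)
  finally show ?thesis .
qed

lemma lifts_translate:
  assumes "lifts q \<tau>"
  shows "lifts (\<lambda>v. q v + int n * k v) \<tau>"
  using assms by (simp add: lifts_def)

text \<open>
  The lift of \<open>\<tau>\<close> is corrected twice: first by a potential \<open>k\<close> on the forest, which gives it the
  windows of \<open>p\<close>, then by a multiple of \<open>n\<close> on each component, which gives it the sum of
  \<open>p\<close> and does not affect the windows.
\<close>

lemma forest_Gcd_imp_connected: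
  assumes forest: "undirected_forest (complement_graph Y)"
    and Gcd: "Gcd (card ` component_of ` V) = 1"
    and \<sigma>\<tau>: "\<sigma> \<in> pverts (FS X Y)" "\<tau> \<in> pverts (FS X Y)"
  shows "(\<sigma>, \<tau>) \<in> (parcs (FS X Y))\<^sup>*"
proof -
  have n0: "int n > 0" using n_ge_3 by simp
  obtain p where p: "lifts p \<sigma>" using ex_lift[OF \<sigma>\<tau>(1)] .
  obtain q where q: "lifts q \<tau>" using ex_lift[OF \<sigma>\<tau>(2)] .
  define w where "w u v = (q u - q v) div int n - (p u - p v) div int n" for u v
  \<comment> \<open>Reversing an edge negates a quotient up to the constant 1, which cancels in \<open>w\<close>.\<close>
  have neg: "(f v - f u) div int n = - ((f u - f v) div int n) - 1"
    if f: "lifts f \<rho>" and uv: "u \<in> V" "v \<in> V" "u \<noteq> v" for f \<rho> u v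
  proof -
    have "\<not> int n dvd f u - f v" using lifts_inj[OF f uv(1,2)] uv(3) by (auto simp: mod_eq_dvd_iff)
    from zdiv_minus_not_dvd[OF n0 this] show ?thesis by simp
  qed
  have antisym: "w v u = - w u v" if "(u, v) \<in> E" for u v
    using that neg[OF p, of u v] neg[OF q, of u v] by (simp add: w_def E_iff)
  have "\<exists>k. \<forall>(u, v)\<in>E. k v - k u = w u v"
  proof (rule bridges_imp_potential[OF finite_E sym_E])
    show "(a, b) \<notin> (E - {(a, b), (b, a)})\<^sup>*" if "(a, b) \<in> E" for a b
      using pair_graph_complement_graph[OF pair_graph_Y] forest that
      by (rule undirected_forest_edge_bridge)
  qed (rule antisym)
  then obtain k where k: "\<forall>(u, v)\<in>E. k v - k u = w u v" by blast
  define q1 where "q1 v = q v + int n * k v" for v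
  have q1: "lifts q1 \<tau>" unfolding q1_def by (rule lifts_translate[OF q])
  have "sum p V mod int n = sum q1 V mod int n" using sum_lift_mod[OF p] sum_lift_mod[OF q1] by simp
  then obtain m where m: "sum p V = sum q1 V + int n * m"
    by (metis mod_eq_dvd_iff dvd_def diff_eq_eq add.commute)
  obtain c where c: "(\<Sum>S\<in>component_of ` V. c S * int (card S)) = 1"
    using Bezout_Gcd[of "component_of ` V" card] finite_V Gcd by auto
  define q2 where "q2 v = q1 v + int n * (m * c (component_of v))" for v
  have q2: "lifts q2 \<tau>" unfolding q2_def by (rule lifts_translate[OF q1])
  have "sum q2 V = sum q1 V + int n * (m * (\<Sum>v\<in>V. c (component_of v)))"
    by (simp add: q2_def sum.distrib sum_distrib_left)
  then have "sum p V = sum q2 V" using m c sum_component_of[of c] by simp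
  moreover have "same_windows p q2"
    unfolding same_windows_def
  proof safe
    fix u v assume uv: "(u, v) \<in> E"
    have "q2 u - q2 v = (q u - q v) + int n * (k u - k v)"
      using component_of_edge[OF uv] by (simp add: q2_def q1_def algebra_simps)
    then have "(q2 u - q2 v) div int n = (k u - k v) + (q u - q v) div int n"
      using n0 by simp
    also have "\<dots> = (p u - p v) div int n" using k uv by (auto simp: w_def)
    finally show "(p u - p v) div int n = (q2 u - q2 v) div int n" by simp
  qed
  ultimately show ?thesis by (intro connected_if_same_sum_same_windows[OF p q2])
qed

section \<open>Connectedness of the swap graph\<close>

lemma FS_connected_iff:
  "connected (with_proj (FS X Y)) \<longleftrightarrow>
     (\<forall>\<sigma>\<in>pverts (FS X Y). \<forall>\<tau>\<in>pverts (FS X Y). (\<sigma>, \<tau>) \<in> (parcs (FS X Y))\<^sup>*)"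
proof -
  have "pair_graph (FS X Y)"
    using n_ge_3 pair_graph_Y by (intro pair_graph_FS pair_graph_cycle_graph) auto
  then interpret F: pair_graph "FS X Y" .
  have "pverts (FS X Y) \<noteq> {}"
    using ex_lifted_arrangement by (metis lifts_def empty_iff)
  then show ?thesis
    by (auto simp: connected_def strongly_connected_def F.reachable_mk_symmetric_eq[OF F.sym_arcs]
        F.reachable_conv)
qed

end

theorem corollary4p14:
  fixes Y :: "'a pair_pre_digraph" and n :: nat
  assumes "pair_graph Y" and "card (pverts Y) = n" and "n \<ge> 3"
  shows "connected (with_proj (FS (cycle_graph n) Y)) \<longleftrightarrow>
    undirected_forest (complement_graph Y) \<and>
    (GCD T\<in>components (complement_graph Y). card (verts T)) = 1"
proof -
  interpret friends_on_cycle Y n using assms by (rule friends_on_cycle.intro)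
  show ?thesis
    unfolding FS_connected_iff Gcd_components
    using connected_imp_forest connected_imp_Gcd forest_Gcd_imp_connected by blast
qed

end
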